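(* Let $\mathcal{L}=(L,\wedge,\vee,0,1)$ be a complete lattice and $X\subseteq L\setminus\{1\}$ a non-empty subset. The following statements are equivalent: (a) $\mathcal{L}$ is a strongly $X$-top lattice; (b) $V:(L,\wedge,\vee)\to(\mathcal{P}(X),\cap,\cup)$ is an anti-homomorphism of lattices (i.e. $V(a\wedge b)=V(a)\cup V(b)$ and $V(a\vee b)=V(a)\cap V(b)$ for all $a,b\in L$).
   Context: For a complete lattice $\mathcal{L}=(L,\wedge,\vee,0,1)$ and a non-empty $X\subseteq L\setminus\{1\}$, let $\mathcal{P}(X)$ be the power set of $X$ and define $V:L\to\mathcal{P}(X)$ by $V(a)=\{p\in X\mid a\le p\}$. An element $p\in L$ is strongly irreducible in $(L,\wedge)$ if for all $a,b\in L$: $a\wedge b\le p$ implies $a\le p$ or $b\le p$. $\mathcal{L}$ is called strongly $X$-top if every element of $X$ is strongly irreducible in $(L,\wedge)$. *)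

theory Defs
  imports Main
begin

definition strongly_irreducible :: "'a::semilattice_inf \<Rightarrow> bool" where
  "strongly_irreducible p \<longleftrightarrow> (\<forall>a b. inf a b \<le> p \<longrightarrow> a \<le> p \<or> b \<le> p)"

definition strongly_top :: "'a::complete_lattice set \<Rightarrow> bool" where
  "strongly_top X \<longleftrightarrow> (\<forall>p\<in>X. strongly_irreducible p)"

definition V :: "'a::complete_lattice set \<Rightarrow> 'a \<Rightarrow> 'a set" where
  "V X a = {p \<in> X. a \<le> p}"

(* The target is the lattice (Pow X, Int, Un); the first conjunct only says that
   f maps into its carrier. *)
definition lattice_antihom_Pow :: "'b set \<Rightarrow> ('a::lattice \<Rightarrow> 'b set) \<Rightarrow> bool" where
  "lattice_antihom_Pow X f \<longleftrightarrow>
     (\<forall>a. f a \<in> Pow X) \<and>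
     (\<forall>a b. f (inf a b) = f a \<union> f b) \<and>
     (\<forall>a b. f (sup a b) = f a \<inter> f b)"

end

theory Submission
  imports Defs
begin

text \<open>A join lies below \<open>p\<close> iff both arguments do, so \<open>V X\<close> always
  turns joins into intersections. Since \<open>inf a b\<close> lies below \<open>a\<close> and
  \<open>b\<close>, one inclusion for meets is also automatic; the other, read at each
  \<open>p\<close> in \<open>X\<close>, is strong irreducibility of \<open>p\<close>
  (\<open>V_inf_eq_iff\<close>).\<close>

lemma V_sup: "V X (sup a b) = V X a \<inter> V X b"
  by (auto simp: V_def)

lemma V_inf_eq_iff:
  "V X (inf a b) = V X a \<union> V X b \<longleftrightarrow> (\<forall>p\<in>X. inf a b \<le> p \<longrightarrow> a \<le> p \<or> b \<le> p)"
  by (auto simp: V_def intro: le_infI1 le_infI2)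

theorem proposition2p5:
  fixes X :: "'a::complete_lattice set"
  assumes "X \<noteq> {}" and "X \<subseteq> UNIV - {top}"
  shows "strongly_top X \<longleftrightarrow> lattice_antihom_Pow X (V X)"
proof -
  have "V X a \<in> Pow X" for a
    by (auto simp: V_def)
  then show ?thesis
    \<comment> \<open>Besides the carrier condition and a trivial equation for joins, the two sides
      now differ only in the order of the quantifiers over \<open>p\<close> and over
      \<open>a\<close>, \<open>b\<close>.\<close>
    unfolding strongly_top_def strongly_irreducible_def lattice_antihom_Pow_def V_inf_eq_iff V_sup
    by blast
qed

end
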